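(* Consider a semi-Markov decision process as described in the context. For any two stationary randomized policies $\pi_1$ and $\pi_2$, $$\eta_{\pi_2}-\eta_{\pi_1}=\frac{1}{\overline m_{\pi_2}}\,\mathbb E_{x\sim d_{\pi_2},\,a\sim\pi_2(\cdot|x)}\left[A_{\pi_1}(x,a)\right],$$ where $d_{\pi_2}$ is the stationary distribution of $P_{\pi_2}$ and $\overline m_{\pi_2}=\mathbb E_{x\sim d_{\pi_2}}[m_{\pi_2}(x)]$ is the mean time between decision epochs under $\pi_2$.
   Context: Semi-Markov decision process (SMDP): finite state space $\mathcal X$, finite action space $\mathcal A$. At a decision epoch in state $x$, action $a$ is chosen; the time to the next decision epoch has cumulative distribution function $F(\cdot|x,a)$, and $P(y|x,a)$ is the probability that the state at the next decision epoch is $y$ (embedded MDP). There exist $\epsilon,\delta>0$ with $F(\delta|x,a)\le1-\epsilon$ for all $(x,a)$. The expected time to the next epoch is $m(x,a)=\int_0^\infty(1-F(s|x,a))\,ds$ (finite). The (finite) expected cost accumulated between consecutive decision epochs is $g(x,a)=k(x,a)+\mathbb E[\int_0^{\tau_1}c(x^{(t)},x,a)\,dt\mid x^{(0)}=x,a^{(0)}=a]$, where $k$ is an instantaneous cost and $c(y,x,a)$ is the cost rate while the natural process occupies $y$ after action $a$ was chosen in $x$, and $\tau_1$ is the time to the next epoch. For a stationary randomized policy $\pi$: $P_\pi(x,y)=P_\pi(y|x)=\sum_a\pi(a|x)P(y|x,a)$, $m_\pi(x)=\sum_am(x,a)\pi(a|x)$, $g_\pi(x)=\sum_ag(x,a)\pi(a|x)$.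 For every stationary policy $P_\pi$ is unichain, with unique stationary distribution $d_\pi$. With $t_k$ the decision epochs and $\tau_k=t_{k+1}-t_k$, the long-run average cost is $$\eta_\pi=\lim_{N\to\infty}\frac{\mathbb E_\pi[\sum_{k=0}^Ng(x^{(t_k)},a^{(t_k)})\mid x^{(0)}\sim\mu]}{\mathbb E_\pi[\sum_{k=0}^N\tau_k\mid x^{(0)}\sim\mu]},$$ independent of the initial distribution $\mu$. The function $h_\pi(x)=\sum_{k=0}^\infty\mathbb E_\pi[g_\pi(x^{(t_k)})-\eta_\pi m_\pi(x^{(t_k)})\mid x^{(0)}=x]$ (the series being assumed to converge) is a solution of the Poisson equation $h(x)=g_\pi(x)-\eta_\pi m_\pi(x)+\sum_yP_\pi(y|x)h(y)$. The advantage function is $A_\pi(x,a)=g(x,a)-\eta_\pi m(x,a)+\sum_yP(y|x,a)h_\pi(y)-h_\pi(x)$. *)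

theory Defs
  imports "HOL-Probability.Probability"
begin

text \<open>
  The randomness between two consecutive decision epochs lives on a measurable space
  \<open>sojourn_space\<close>. If action \<open>a\<close> is chosen in state \<open>x\<close>, a point \<open>w\<close> of it is drawn
  from \<open>sojourn_law x a\<close>; then \<open>sojourn_time w\<close> is the time to the next decision epoch and
  \<open>natural_state t w\<close> is the state of the natural process \<open>t\<close> time units after the
  current epoch (only \<open>0 \<le> t \<le> sojourn_time w\<close> is relevant).
  The cost rate \<open>c(y, x, a)\<close> is \<open>cost_rate y x a\<close>.
\<close>

record ('x, 'a, 'w) smdp_model =
  sojourn_space :: "'w measure"
  sojourn_law   :: "'x \<Rightarrow> 'a \<Rightarrow> 'w measure"
  sojourn_time  :: "'w \<Rightarrow> real"
  natural_state :: "real \<Rightarrow> 'w \<Rightarrow> 'x"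
  inst_cost     :: "'x \<Rightarrow> 'a \<Rightarrow> real"
  cost_rate     :: "'x \<Rightarrow> 'x \<Rightarrow> 'a \<Rightarrow> real"

definition next_state :: "('x, 'a, 'w) smdp_model \<Rightarrow> 'w \<Rightarrow> 'x" where
  "next_state S w = natural_state S (sojourn_time S w) w"

text \<open>\<open>sojourn_cdf S s x a\<close> is \<open>F(s | x, a)\<close> and \<open>trans_prob S y x a\<close> is \<open>P(y | x, a)\<close>.\<close>

definition sojourn_cdf :: "('x, 'a, 'w) smdp_model \<Rightarrow> real \<Rightarrow> 'x \<Rightarrow> 'a \<Rightarrow> real" where
  "sojourn_cdf S s x a =
     measure (sojourn_law S x a) {w \<in> space (sojourn_space S). sojourn_time S w \<le> s}"

definition trans_prob :: "('x, 'a, 'w) smdp_model \<Rightarrow> 'x \<Rightarrow> 'x \<Rightarrow> 'a \<Rightarrow> real" where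
  "trans_prob S y x a =
     measure (sojourn_law S x a) {w \<in> space (sojourn_space S). next_state S w = y}"

definition mean_time :: "('x, 'a, 'w) smdp_model \<Rightarrow> 'x \<Rightarrow> 'a \<Rightarrow> real" where
  "mean_time S x a = (LINT s:{0..}|lborel. (1 - sojourn_cdf S s x a))"

definition running_cost :: "('x, 'a, 'w) smdp_model \<Rightarrow> 'x \<Rightarrow> 'a \<Rightarrow> 'w \<Rightarrow> real" where
  "running_cost S x a w =
     (LINT t:{0..sojourn_time S w}|lborel. cost_rate S (natural_state S t w) x a)"

definition epoch_cost :: "('x, 'a, 'w) smdp_model \<Rightarrow> 'x \<Rightarrow> 'a \<Rightarrow> real" where
  "epoch_cost S x a = inst_cost S x a + (LINT w|sojourn_law S x a. running_cost S x a w)"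

type_synonym ('x, 'a) policy = "'x \<Rightarrow> 'a pmf"

definition trans_pol :: "('x, 'a::finite, 'w) smdp_model \<Rightarrow> ('x, 'a) policy \<Rightarrow> 'x \<Rightarrow> 'x \<Rightarrow> real" where
  "trans_pol S \<pi> x y = (\<Sum>a\<in>UNIV. pmf (\<pi> x) a * trans_prob S y x a)"

definition mean_time_pol :: "('x, 'a::finite, 'w) smdp_model \<Rightarrow> ('x, 'a) policy \<Rightarrow> 'x \<Rightarrow> real" where
  "mean_time_pol S \<pi> x = (\<Sum>a\<in>UNIV. mean_time S x a * pmf (\<pi> x) a)"

definition epoch_cost_pol :: "('x, 'a::finite, 'w) smdp_model \<Rightarrow> ('x, 'a) policy \<Rightarrow> 'x \<Rightarrow> real" where
  "epoch_cost_pol S \<pi> x = (\<Sum>a\<in>UNIV. epoch_cost S x a * pmf (\<pi> x) a)"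

text \<open>
  Finite chains: the recurrent classes are the closed communicating classes, and a chain is
  unichain if it has exactly one of them (all other states being transient).
\<close>

definition reaches :: "('x \<Rightarrow> 'x \<Rightarrow> real) \<Rightarrow> 'x \<Rightarrow> 'x \<Rightarrow> bool" where
  "reaches P = (\<lambda>x y. P x y > 0)\<^sup>*\<^sup>*"

definition recurrent_class :: "('x \<Rightarrow> 'x \<Rightarrow> real) \<Rightarrow> 'x set \<Rightarrow> bool" where
  "recurrent_class P C \<longleftrightarrow>
     C \<noteq> {} \<and> (\<forall>x\<in>C. \<forall>y\<in>C. reaches P x y) \<and> (\<forall>x\<in>C. \<forall>y. reaches P x y \<longrightarrow> y \<in> C)"

definition unichain :: "('x::finite \<Rightarrow> 'x \<Rightarrow> real) \<Rightarrow> bool" where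
  "unichain P \<longleftrightarrow> (\<exists>!C. recurrent_class P C)"

definition stationary_for :: "('x::finite \<Rightarrow> 'x \<Rightarrow> real) \<Rightarrow> 'x pmf \<Rightarrow> bool" where
  "stationary_for P d \<longleftrightarrow> (\<forall>y. (\<Sum>x\<in>UNIV. pmf d x * P x y) = pmf d y)"

definition stat_dist :: "('x::finite, 'a::finite, 'w) smdp_model \<Rightarrow> ('x, 'a) policy \<Rightarrow> 'x pmf" where
  "stat_dist S \<pi> = (THE d. stationary_for (trans_pol S \<pi>) d)"

text \<open>
  \<open>finite_mean_time\<close> and \<open>finite_cost\<close> say that \<open>m\<close> and \<open>g\<close> are finite.
  The natural process starts in \<open>x\<close>; this is required only for positive sojourn times, since
  for a zero sojourn time the state at time \<open>0\<close> is already that of the next epoch.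
\<close>

locale smdp =
  fixes S :: "('x::finite, 'a::finite, 'w) smdp_model"
  assumes prob_space_law: "\<And>x a. prob_space (sojourn_law S x a)"
    and sets_law: "\<And>x a. sets (sojourn_law S x a) = sets (sojourn_space S)"
    and time_measurable: "sojourn_time S \<in> borel_measurable (sojourn_space S)"
    and time_nonneg: "\<And>w. w \<in> space (sojourn_space S) \<Longrightarrow> 0 \<le> sojourn_time S w"
    and state_measurable:
      "(\<lambda>(t, w). natural_state S t w) \<in>
         measurable (borel \<Otimes>\<^sub>M sojourn_space S) (count_space UNIV)"
    and state_initial:
      "\<And>x a. AE w in sojourn_law S x a. 0 < sojourn_time S w \<longrightarrow> natural_state S 0 w = x"
    and no_accumulation:
      "\<exists>\<epsilon>>0. \<exists>\<delta>>0. \<forall>x a. sojourn_cdf S \<delta> x a \<le> 1 - \<epsilon>"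
    and finite_mean_time:
      "\<And>x a. set_integrable lborel {0..} (\<lambda>s. 1 - sojourn_cdf S s x a)"
    and finite_cost:
      "\<And>x a. integrable (sojourn_law S x a) (running_cost S x a)"
    and unichain_pol: "\<And>\<pi>. unichain (trans_pol S \<pi>)"

text \<open>
  The process under a policy: the \<open>k\<close>-th coordinate of a trajectory is the triple of state,
  action and sojourn sample point at the \<open>k\<close>-th decision epoch, so the state at epoch
  \<open>k + 1\<close> is \<open>next_state\<close> of the \<open>k\<close>-th sample point. Its law with initial distribution
  \<open>\<mu>\<close> is the Ionescu-Tulcea measure.
\<close>

definition epoch_space :: "('x, 'a, 'w) smdp_model \<Rightarrow> ('x \<times> 'a \<times> 'w) measure" where
  "epoch_space S = count_space UNIV \<Otimes>\<^sub>M (count_space UNIV \<Otimes>\<^sub>M sojourn_space S)"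

definition epoch_law ::
    "('x, 'a, 'w) smdp_model \<Rightarrow> ('x, 'a) policy \<Rightarrow> 'x \<Rightarrow> ('x \<times> 'a \<times> 'w) measure" where
  "epoch_law S \<pi> x =
     measure_pmf (\<pi> x) \<bind> (\<lambda>a. distr (sojourn_law S x a) (epoch_space S) (\<lambda>w. (x, a, w)))"

definition epoch_kernel ::
    "('x, 'a, 'w) smdp_model \<Rightarrow> ('x, 'a) policy \<Rightarrow> 'x pmf \<Rightarrow>
      nat \<Rightarrow> (nat \<Rightarrow> 'x \<times> 'a \<times> 'w) \<Rightarrow> ('x \<times> 'a \<times> 'w) measure" where
  "epoch_kernel S \<pi> \<mu> k \<omega> =
     (case k of
        0 \<Rightarrow> measure_pmf \<mu> \<bind> epoch_law S \<pi>
      | Suc j \<Rightarrow> epoch_law S \<pi> (next_state S (snd (snd (\<omega> j)))))"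

definition trajectories ::
    "('x, 'a, 'w) smdp_model \<Rightarrow> ('x, 'a) policy \<Rightarrow> 'x pmf \<Rightarrow> (nat \<Rightarrow> 'x \<times> 'a \<times> 'w) measure" where
  "trajectories S \<pi> \<mu> =
     projective_family.lim UNIV
       (Ionescu_Tulcea.CI (epoch_kernel S \<pi> \<mu>) (\<lambda>_. epoch_space S)) (\<lambda>_. epoch_space S)"

definition epoch_state :: "nat \<Rightarrow> (nat \<Rightarrow> 'x \<times> 'a \<times> 'w) \<Rightarrow> 'x" where
  "epoch_state k \<omega> = fst (\<omega> k)"

definition epoch_action :: "nat \<Rightarrow> (nat \<Rightarrow> 'x \<times> 'a \<times> 'w) \<Rightarrow> 'a" where
  "epoch_action k \<omega> = fst (snd (\<omega> k))"

definition epoch_sojourn :: "('x, 'a, 'w) smdp_model \<Rightarrow> nat \<Rightarrow> (nat \<Rightarrow> 'x \<times> 'a \<times> 'w) \<Rightarrow> real" where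
  "epoch_sojourn S k \<omega> = sojourn_time S (snd (snd (\<omega> k)))"

definition cost_ratio :: "('x, 'a, 'w) smdp_model \<Rightarrow> ('x, 'a) policy \<Rightarrow> 'x pmf \<Rightarrow> nat \<Rightarrow> real" where
  "cost_ratio S \<pi> \<mu> N =
     (LINT \<omega>|trajectories S \<pi> \<mu>. (\<Sum>k=0..N. epoch_cost S (epoch_state k \<omega>) (epoch_action k \<omega>))) /
     (LINT \<omega>|trajectories S \<pi> \<mu>. (\<Sum>k=0..N. epoch_sojourn S k \<omega>))"

text \<open>The long-run average cost is the common limit for all initial distributions.\<close>

definition avg_cost :: "('x, 'a, 'w) smdp_model \<Rightarrow> ('x, 'a) policy \<Rightarrow> real" where
  "avg_cost S \<pi> = (THE \<eta>. \<forall>\<mu>. cost_ratio S \<pi> \<mu> \<longlonglongrightarrow> \<eta>)"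

definition relative_cost ::
    "('x, 'a::finite, 'w) smdp_model \<Rightarrow> ('x, 'a) policy \<Rightarrow> 'x \<Rightarrow> nat \<Rightarrow> real" where
  "relative_cost S \<pi> x k =
     (LINT \<omega>|trajectories S \<pi> (return_pmf x).
        (epoch_cost_pol S \<pi> (epoch_state k \<omega>) - avg_cost S \<pi> * mean_time_pol S \<pi> (epoch_state k \<omega>)))"

definition bias :: "('x, 'a::finite, 'w) smdp_model \<Rightarrow> ('x, 'a) policy \<Rightarrow> 'x \<Rightarrow> real" where
  "bias S \<pi> x = (\<Sum>k. relative_cost S \<pi> x k)"

definition advantage ::
    "('x::finite, 'a::finite, 'w) smdp_model \<Rightarrow> ('x, 'a) policy \<Rightarrow> 'x \<Rightarrow> 'a \<Rightarrow> real" where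
  "advantage S \<pi> x a =
     epoch_cost S x a - avg_cost S \<pi> * mean_time S x a
       + (\<Sum>y\<in>UNIV. trans_prob S y x a * bias S \<pi> y) - bias S \<pi> x"

definition mean_epoch_time :: "('x::finite, 'a::finite, 'w) smdp_model \<Rightarrow> ('x, 'a) policy \<Rightarrow> real" where
  "mean_epoch_time S \<pi> = measure_pmf.expectation (stat_dist S \<pi>) (mean_time_pol S \<pi>)"

context smdp
begin

lemma space_law: "space (sojourn_law S x a) = space (sojourn_space S)"
  using sets_law by (rule sets_eq_imp_space_eq)

lemma next_state_measurable: "next_state S \<in> measurable (sojourn_space S) (count_space UNIV)"
proof -
  have "(\<lambda>w. (sojourn_time S w, w)) \<in> measurable (sojourn_space S) (borel \<Otimes>\<^sub>M sojourn_space S)"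
    using time_measurable by measurable
  from measurable_compose[OF this state_measurable] show ?thesis
    by (simp add: next_state_def[abs_def])
qed

lemma triple_measurable: "(\<lambda>w. (x, a, w)) \<in> measurable (sojourn_law S x a) (epoch_space S)"
  unfolding epoch_space_def measurable_cong_sets[OF sets_law refl] by measurable

lemma distr_law_in_prob_algebra:
  "distr (sojourn_law S x a) (epoch_space S) (\<lambda>w. (x, a, w)) \<in> space (prob_algebra (epoch_space S))"
  by (auto simp: space_prob_algebra
      intro!: prob_space.prob_space_distr prob_space_law triple_measurable)

lemma pmf_bind_in_prob_algebra:
  assumes "\<And>x. f x \<in> space (prob_algebra M)"
  shows "measure_pmf p \<bind> f \<in> space (prob_algebra M)"
proof -
  have "(\<lambda>_::unit. measure_pmf p) \<in> measurable (count_space UNIV) (prob_algebra (count_space UNIV))"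
    by (simp add: space_prob_algebra prob_space_measure_pmf)
  moreover have "f \<in> measurable (count_space UNIV) (prob_algebra M)"
    using assms by simp
  ultimately have "(\<lambda>_::unit. measure_pmf p \<bind> f) \<in> measurable (count_space UNIV) (prob_algebra M)"
    by (rule measurable_bind_prob_space)
  from measurable_space[OF this] show ?thesis
    by simp
qed

lemma epoch_law_in_prob_algebra: "epoch_law S \<pi> x \<in> space (prob_algebra (epoch_space S))"
  unfolding epoch_law_def by (intro pmf_bind_in_prob_algebra distr_law_in_prob_algebra)

lemma epoch_kernel_measurable:
  "epoch_kernel S \<pi> \<mu> k \<in>
     measurable (PiM {0..<k} (\<lambda>_. epoch_space S)) (prob_algebra (epoch_space S))"
proof (cases k)
  case 0
  then show ?thesis
    by (simp add: epoch_kernel_def[abs_def] pmf_bind_in_prob_algebra epoch_law_in_prob_algebra)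
next
  case (Suc j)
  have "(\<lambda>\<omega>. \<omega> j) \<in> measurable (PiM {0..<k} (\<lambda>_. epoch_space S)) (epoch_space S)"
    using Suc by (intro measurable_component_singleton) auto
  then have "(\<lambda>\<omega>. snd (snd (\<omega> j))) \<in> measurable (PiM {0..<k} (\<lambda>_. epoch_space S)) (sojourn_space S)"
    unfolding epoch_space_def by measurable
  from measurable_compose[OF this next_state_measurable]
  have "(\<lambda>\<omega>. next_state S (snd (snd (\<omega> j)))) \<in>
      measurable (PiM {0..<k} (\<lambda>_. epoch_space S)) (count_space UNIV)" .
  moreover have "epoch_law S \<pi> \<in> measurable (count_space UNIV) (prob_algebra (epoch_space S))"
    by (simp add: epoch_law_in_prob_algebra)
  ultimately have "(\<lambda>\<omega>. epoch_law S \<pi> (next_state S (snd (snd (\<omega> j))))) \<in>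
      measurable (PiM {0..<k} (\<lambda>_. epoch_space S)) (prob_algebra (epoch_space S))"
    by (rule measurable_compose)
  then show ?thesis
    using Suc by (simp add: epoch_kernel_def[abs_def])
qed

lemma Ionescu_Tulcea_epoch_kernel:
  "Ionescu_Tulcea (epoch_kernel S \<pi> \<mu>) (\<lambda>_. epoch_space S)"
proof (rule Ionescu_Tulcea.intro)
  show "epoch_kernel S \<pi> \<mu> i \<in>
      measurable (PiM {0..<i} (\<lambda>_. epoch_space S)) (subprob_algebra (epoch_space S))" for i
    by (rule measurable_prob_algebraD[OF epoch_kernel_measurable])
  show "prob_space (epoch_kernel S \<pi> \<mu> i \<omega>)"
    if "\<omega> \<in> space (PiM {0..<i} (\<lambda>_. epoch_space S))" for i \<omega>
    using measurable_space[OF epoch_kernel_measurable that] by (simp add: space_prob_algebra)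
qed

lemma trajectories_marginal:
  assumes "finite J"
  shows "distr (trajectories S \<pi> \<mu>) (PiM J (\<lambda>_. epoch_space S)) (\<lambda>\<omega>. restrict \<omega> J) =
    Ionescu_Tulcea.CI (epoch_kernel S \<pi> \<mu>) (\<lambda>_. epoch_space S) J"
  unfolding trajectories_def
  by (rule Ionescu_Tulcea.distr_lim[OF Ionescu_Tulcea_epoch_kernel assms])

end

end

theory Submission
  imports Defs
begin

text \<open>
  Averaging the advantage of \<open>\<pi>\<^sub>1\<close> over \<open>\<pi>\<^sub>2\<close> and the stationary distribution \<open>d\<close> of \<open>\<pi>\<^sub>2\<close> cancels
  the bias terms by stationarity and leaves \<open>d g - \<eta>\<^sub>1 d m\<close>, where \<open>g\<close> and \<open>m\<close> are the epoch cost
  and mean time of \<open>\<pi>\<^sub>2\<close>; the renewal-reward formula \<open>\<eta>\<^sub>2 = d g / d m\<close> then gives the claim.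
  The latter is the ergodic theorem in Cesaro mean: for a unichain stochastic matrix \<open>P\<close> every
  function is of the form \<open>c + u - P u\<close>, whose Cesaro means telescope to \<open>c\<close>.
\<close>

section \<open>Finite unichain Markov chains\<close>

definition stochastic :: "('x::finite \<Rightarrow> 'x \<Rightarrow> real) \<Rightarrow> bool" where
  "stochastic P \<longleftrightarrow> (\<forall>x y. 0 \<le> P x y) \<and> (\<forall>x. (\<Sum>y\<in>UNIV. P x y) = 1)"

definition transition_op :: "('x::finite \<Rightarrow> 'x \<Rightarrow> real) \<Rightarrow> ('x \<Rightarrow> real) \<Rightarrow> 'x \<Rightarrow> real" where
  "transition_op P f x = (\<Sum>y\<in>UNIV. P x y * f y)"

lemma transition_op_diff:
  "transition_op P (\<lambda>x. f x - g x) = (\<lambda>x. transition_op P f x - transition_op P g x)"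
  by (simp add: transition_op_def right_diff_distrib sum_subtractf fun_eq_iff)

lemma transition_op_add:
  "transition_op P (\<lambda>x. f x + g x) = (\<lambda>x. transition_op P f x + transition_op P g x)"
  by (simp add: transition_op_def distrib_left sum.distrib fun_eq_iff)

lemma transition_op_const: "stochastic P \<Longrightarrow> transition_op P (\<lambda>_. c) = (\<lambda>_. c)"
  by (simp add: transition_op_def stochastic_def fun_eq_iff flip: sum_distrib_right)

lemma transition_op_nonneg: "stochastic P \<Longrightarrow> (\<And>x. 0 \<le> f x) \<Longrightarrow> 0 \<le> transition_op P f x"
  by (auto simp: transition_op_def stochastic_def intro!: sum_nonneg)

lemma transition_pow_diff:
  "(transition_op P ^^ k) (\<lambda>x. f x - g x) =
     (\<lambda>x. (transition_op P ^^ k) f x - (transition_op P ^^ k) g x)"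
  by (induction k) (simp_all add: transition_op_diff)

lemma transition_pow_add:
  "(transition_op P ^^ k) (\<lambda>x. f x + g x) =
     (\<lambda>x. (transition_op P ^^ k) f x + (transition_op P ^^ k) g x)"
  by (induction k) (simp_all add: transition_op_add)

lemma transition_pow_const: "stochastic P \<Longrightarrow> (transition_op P ^^ k) (\<lambda>_. c) = (\<lambda>_. c)"
  by (induction k) (simp_all add: transition_op_const)

lemma transition_pow_nonneg:
  "stochastic P \<Longrightarrow> (\<And>x. 0 \<le> f x) \<Longrightarrow> 0 \<le> (transition_op P ^^ k) f x"
  by (induction k arbitrary: x) (simp_all add: transition_op_nonneg)

lemma transition_pow_le:
  assumes "stochastic P" and "\<And>x. f x \<le> g x"
  shows "(transition_op P ^^ k) f x \<le> (transition_op P ^^ k) g x"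
  using transition_pow_nonneg[of P "\<lambda>x. g x - f x" k x] assms by (simp add: transition_pow_diff)

text \<open>Powers of a stochastic matrix are monotone and fix constants, so a two-sided constant
  bound on \<open>f\<close> persists. The bound is crude; what matters later is that it is uniform
  in \<open>k\<close>.\<close>

lemma transition_pow_bounded:
  assumes "stochastic P"
  shows "\<bar>(transition_op P ^^ k) f x\<bar> \<le> (\<Sum>y\<in>UNIV. \<bar>f y\<bar>)"
proof -
  let ?B = "\<Sum>y\<in>UNIV. \<bar>f y\<bar>"
  have b: "\<bar>f y\<bar> \<le> ?B" for y
    by (rule member_le_sum) auto
  then have "f y \<le> ?B" "- ?B \<le> f y" for y
    by (simp_all add: abs_le_iff minus_le_iff)
  from transition_pow_le[OF assms this(1)] transition_pow_le[OF assms this(2)] show ?thesis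
    by (simp add: transition_pow_const[OF assms] abs_le_iff minus_le_iff)
qed

section \<open>Recurrent classes and harmonic functions\<close>

text \<open>Take a state of \<open>A\<close> whose set of reachable states has least cardinality.
  Each state reached from it reaches a subset of that set, by minimality all of it, so these states
  communicate.\<close>

lemma closed_set_recurrent_class:
  fixes P :: "'x::finite \<Rightarrow> 'x \<Rightarrow> real"
  assumes "A \<noteq> {}" and closed: "\<And>x y. x \<in> A \<Longrightarrow> P x y > 0 \<Longrightarrow> y \<in> A"
  shows "\<exists>C. recurrent_class P C \<and> C \<subseteq> A"
proof -
  define R where "R x = {y. reaches P x y}" for x
  have refl: "x \<in> R x" for x
    by (simp add: R_def reaches_def)
  have trans: "R y \<subseteq> R x" if "y \<in> R x" for x y
    using that by (auto simp: R_def reaches_def)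
  have RA: "R x \<subseteq> A" if "x \<in> A" for x
  proof
    fix y assume "y \<in> R x"
    then have "(\<lambda>x y. P x y > 0)\<^sup>*\<^sup>* x y"
      by (simp add: R_def reaches_def)
    then show "y \<in> A"
      by induction (use that closed in auto)
  qed
  obtain x where x: "x \<in> A" and min: "\<And>y. y \<in> A \<Longrightarrow> card (R x) \<le> card (R y)"
    using ex_has_least_nat[of "\<lambda>x. x \<in> A" _ "\<lambda>x. card (R x)"] assms(1) by blast
  have eq: "R y = R x" if "y \<in> R x" for y
  proof (rule card_seteq)
    show "card (R x) \<le> card (R y)"
      using that RA[OF x] by (intro min) auto
  qed (use trans[OF that] in auto)
  have "recurrent_class P (R x)"
    unfolding recurrent_class_def
  proof (intro conjI ballI allI impI)
    show "reaches P y z" if "y \<in> R x" "z \<in> R x" for y z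
      using eq[OF that(1)] that(2) by (auto simp: R_def)
    show "z \<in> R x" if "y \<in> R x" "reaches P y z" for y z
      using trans[OF that(1)] that(2) by (auto simp: R_def)
  qed (use refl in auto)
  with RA[OF x] show ?thesis
    by blast
qed

text \<open>Maximum principle: the nonnegative gaps \<open>u x - u y\<close> average to zero under
  \<open>P x\<close>, so each gap of positive weight vanishes.\<close>

lemma harmonic_max_closed:
  assumes P: "stochastic P" and harm: "transition_op P u = u"
    and max: "\<And>y. u y \<le> u x" and pos: "P x y > 0"
  shows "u y = u x"
proof -
  have "transition_op P (\<lambda>y. u x - u y) x = 0"
    using harm by (simp add: transition_op_diff transition_op_const[OF P])
  then have "P x y * (u x - u y) = 0"
    using P max by (subst (asm) transition_op_def, subst (asm) sum_nonneg_eq_0_iff)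
      (auto simp: stochastic_def)
  with pos show ?thesis
    by simp
qed

text \<open>The maximisers form a nonempty set by finiteness, and a closed one by the maximum
  principle.\<close>

lemma harmonic_max_recurrent_class:
  assumes P: "stochastic P" and harm: "transition_op P u = u"
  shows "\<exists>C. recurrent_class P C \<and> C \<subseteq> {x. \<forall>y. u y \<le> u x}"
proof (rule closed_set_recurrent_class)
  have "Max (range u) \<in> range u"
    by (intro Max_in) auto
  then obtain x where "u x = Max (range u)"
    by (metis imageE)
  then have "\<forall>y. u y \<le> u x"
    by simp
  then show "{x. \<forall>y. u y \<le> u x} \<noteq> {}"
    by blast
  show "y \<in> {x. \<forall>y. u y \<le> u x}" if "x \<in> {x. \<forall>y. u y \<le> u x}" "P x y > 0" for x y
    using harmonic_max_closed[OF P harm _ that(2)] that(1) by simp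
qed

text \<open>Maximisers of \<open>u\<close> and of \<open>- u\<close> each contain a recurrent class.
  There is only one such class, so some state both maximises and minimises \<open>u\<close>.\<close>

lemma unichain_harmonic_const:
  assumes P: "stochastic P" and "unichain P" and harm: "transition_op P u = u"
  shows "u x = u y"
proof -
  have "transition_op P (\<lambda>x. - u x) = (\<lambda>x. - u x)"
    using transition_op_diff[of P "\<lambda>_. 0" u] harm by (simp add: transition_op_const[OF P])
  from harmonic_max_recurrent_class[OF P harm] harmonic_max_recurrent_class[OF P this]
  obtain C C' where C: "recurrent_class P C" "C \<subseteq> {x. \<forall>y. u y \<le> u x}"
    and C': "recurrent_class P C'" "C' \<subseteq> {x. \<forall>y. - u y \<le> - u x}"
    by blast
  have "C = C'"
    using \<open>unichain P\<close> C(1) C'(1) by (auto simp: unichain_def)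
  moreover obtain z where "z \<in> C"
    using C(1) by (auto simp: recurrent_class_def)
  ultimately have "u y \<le> u z" "u z \<le> u y" for y
    using C(2) C'(2) by auto
  then show ?thesis
    by (meson antisym order_trans)
qed

text \<open>
  Fredholm argument: \<open>u \<mapsto> u - P u + u x\<^sub>0\<close> is injective, hence surjective. Indeed, for \<open>u\<close> in the
  kernel \<open>P\<^sup>k u = u + k u x\<^sub>0\<close> is bounded in \<open>k\<close>, so \<open>u\<close> is harmonic and vanishes at \<open>x\<^sub>0\<close>.
\<close>

lemma unichain_poisson_solvable:
  fixes P :: "'x::finite \<Rightarrow> 'x \<Rightarrow> real"
  assumes P: "stochastic P" and uni: "unichain P"
  shows "\<exists>c u. f = (\<lambda>x. c + u x - transition_op P u x)"
proof -
  \<comment> \<open>Any state will do. The term \<open>v $ x0\<close> removes the constants from the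
    kernel of \<open>v - P v\<close>, and \<open>real ^ 'x\<close> is a Euclidean space, where an
    injective linear endomorphism is surjective.\<close>
  define x0 :: 'x where "x0 = undefined"
  define L :: "real ^ 'x \<Rightarrow> real ^ 'x"
    where "L v = (\<chi> x. v $ x - transition_op P (($) v) x + v $ x0)" for v
  have "linear L"
    by (rule linearI)
      (simp_all add: L_def vec_eq_iff transition_op_def algebra_simps sum.distrib sum_distrib_left)
  moreover have "inj L"
  proof (subst linear_injective_0[OF \<open>linear L\<close>], intro allI impI)
    fix v assume "L v = 0"
    then have v: "v $ x - transition_op P (($) v) x + v $ x0 = 0" for x
      by (simp add: L_def vec_eq_iff)
    define a where "a = v $ x0"
    have Pv: "transition_op P (($) v) = (\<lambda>x. v $ x + a)"
      using v by (simp add: fun_eq_iff a_def algebra_simps)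
    have Pk: "(transition_op P ^^ k) (($) v) = (\<lambda>x. v $ x + real k * a)" for k
      by (induction k)
        (simp_all add: transition_op_add transition_op_const[OF P] Pv algebra_simps)
    have bound: "real k * \<bar>a\<bar> \<le> 2 * (\<Sum>y\<in>UNIV. \<bar>v $ y\<bar>)" for k
    proof -
      have "real k * \<bar>a\<bar> = \<bar>(transition_op P ^^ k) (($) v) x0 - v $ x0\<bar>"
        by (simp add: Pk abs_mult)
      \<comment> \<open>Reading \<open>v $ x0\<close> as the zeroth power lets the same bound serve
        both terms, whence the factor 2.\<close>
      also have "\<dots> \<le> \<bar>(transition_op P ^^ k) (($) v) x0\<bar> + \<bar>(transition_op P ^^ 0) (($) v) x0\<bar>"
        by simp
      also have "\<dots> \<le> 2 * (\<Sum>y\<in>UNIV. \<bar>v $ y\<bar>)"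
        using transition_pow_bounded[OF P, of k "($) v" x0]
          transition_pow_bounded[OF P, of 0 "($) v" x0] by linarith
      finally show ?thesis .
    qed
    have "a = 0"
    proof (rule ccontr)
      assume "a \<noteq> 0"
      then obtain k where "2 * (\<Sum>y\<in>UNIV. \<bar>v $ y\<bar>) < real k * \<bar>a\<bar>"
        using reals_Archimedean3[of "\<bar>a\<bar>"] by auto
      with bound[of k] show False
        by simp
    qed
    with Pv have "transition_op P (($) v) = ($) v"
      by simp
    from unichain_harmonic_const[OF P uni this, of _ x0] \<open>a = 0\<close> show "v = 0"
      by (simp add: vec_eq_iff a_def)
  qed
  ultimately have "surj L"
    by (rule linear_inj_imp_surj)
  then obtain v where v: "L v = (\<chi> x. f x)"
    by (metis surjD)
  \<comment> \<open>The normalising term of \<open>L\<close> supplies the constant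
    \<open>c\<close>.\<close>
  have "f = (\<lambda>x. v $ x0 + v $ x - transition_op P (($) v) x)"
  proof
    fix x
    have "L v $ x = f x"
      by (simp add: v)
    then show "f x = v $ x0 + v $ x - transition_op P (($) v) x"
      by (simp add: L_def algebra_simps)
  qed
  then show ?thesis
    by blast
qed

section \<open>Cesaro means of the powers\<close>

text \<open>Applying the \<open>k\<close>-th power to \<open>u - P u\<close> gives a difference of
  consecutive powers. After summation only \<open>u x\<close> and the power \<open>Suc N\<close>
  remain; both are bounded uniformly in \<open>N\<close>, so division by \<open>Suc N\<close>
  removes them.\<close>

lemma cesaro_telescope:
  assumes P: "stochastic P" and f: "f = (\<lambda>x. c + u x - transition_op P u x)"
  shows "(\<lambda>N. (\<Sum>k=0..N. (transition_op P ^^ k) f x) / real (Suc N)) \<longlonglongrightarrow> c"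
proof -
  have pow: "(transition_op P ^^ k) f x =
      c + ((transition_op P ^^ k) u x - (transition_op P ^^ Suc k) u x)" for k
    unfolding f transition_pow_diff transition_pow_add transition_pow_const[OF P] funpow_Suc_right
    by simp
  have "(\<Sum>k=0..N. (transition_op P ^^ k) f x) = real (Suc N) * c + (u x - (transition_op P ^^ Suc N) u x)" for N
    unfolding pow sum.distrib
    using sum_telescope[of "\<lambda>k. (transition_op P ^^ k) u x" N] by (simp add: atMost_atLeast0)
  then have eq: "(\<Sum>k=0..N. (transition_op P ^^ k) f x) / real (Suc N) =
      c + (u x - (transition_op P ^^ Suc N) u x) / real (Suc N)" for N
    by (simp add: add_divide_distrib del: of_nat_Suc)
  define B where "B = 2 * (\<Sum>y\<in>UNIV. \<bar>u y\<bar>)"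
  have "(\<lambda>N. B / real (Suc N)) \<longlonglongrightarrow> 0"
    using tendsto_mult_right_zero[OF LIMSEQ_inverse_real_of_nat, of B] by (simp add: divide_inverse)
  then have "(\<lambda>N. (u x - (transition_op P ^^ Suc N) u x) / real (Suc N)) \<longlonglongrightarrow> 0"
  proof (rule Lim_null_comparison[rotated], intro always_eventually allI)
    fix N
    have "\<bar>u x - (transition_op P ^^ Suc N) u x\<bar> \<le> B"
      using transition_pow_bounded[OF P, of "Suc N" u x] transition_pow_bounded[OF P, of 0 u x]
      unfolding B_def funpow_0 id_apply by linarith
    then show "norm ((u x - (transition_op P ^^ Suc N) u x) / real (Suc N)) \<le> B / real (Suc N)"
      by (simp add: divide_right_mono del: of_nat_Suc funpow.simps)
  qed
  from tendsto_add[OF tendsto_const[of c] this] show ?thesis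
    by (simp only: eq add_0_right)
qed

section \<open>Stationary distributions: ergodic averages, uniqueness, existence\<close>

text \<open>Dual form of invariance: exchanging the sums lets \<open>P\<close> act on
  \<open>d\<close>, which it fixes.\<close>

lemma stationary_transition_op:
  assumes "stationary_for P d"
  shows "(\<Sum>x\<in>UNIV. pmf d x * transition_op P u x) = (\<Sum>x\<in>UNIV. pmf d x * u x)"
proof -
  have "(\<Sum>x\<in>UNIV. pmf d x * transition_op P u x) = (\<Sum>y\<in>UNIV. (\<Sum>x\<in>UNIV. pmf d x * P x y) * u y)"
    unfolding transition_op_def sum_distrib_left sum_distrib_right
    by (subst sum.swap) (simp add: mult.assoc)
  also have "\<dots> = (\<Sum>x\<in>UNIV. pmf d x * u x)"
    using assms by (simp add: stationary_for_def)
  finally show ?thesis .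
qed

lemma sum_pmf_finite_UNIV: "(\<Sum>x\<in>UNIV. pmf (d :: 'x::finite pmf) x) = 1"
  by (rule sum_pmf_eq_1) auto

text \<open>Integration against \<open>d\<close> cancels \<open>u\<close> with \<open>P u\<close>,
  and \<open>d\<close> has mass one; this identifies the constant of the decomposition.\<close>

lemma stationary_poisson:
  fixes d :: "'x::finite pmf"
  assumes "stationary_for P d" and "f = (\<lambda>x. c + u x - transition_op P u x)"
  shows "(\<Sum>x\<in>UNIV. pmf d x * f x) = c"
  using stationary_transition_op[OF assms(1), of u]
  by (simp add: assms(2) distrib_left right_diff_distrib sum.distrib sum_subtractf
      sum_pmf_finite_UNIV flip: sum_distrib_right)

text \<open>The constant \<open>c\<close> of the decomposition of \<open>f\<close> is both the
  Cesaro limit and the stationary mean.\<close>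

lemma unichain_cesaro:
  assumes "stochastic P" and "unichain P" and "stationary_for P d"
  shows "(\<lambda>N. (\<Sum>k=0..N. (transition_op P ^^ k) f x) / real (Suc N)) \<longlonglongrightarrow>
    (\<Sum>x\<in>UNIV. pmf d x * f x)"
proof -
  obtain c u where f: "f = (\<lambda>x. c + u x - transition_op P u x)"
    using unichain_poisson_solvable[OF assms(1,2)] by blast
  from cesaro_telescope[OF assms(1) f] stationary_poisson[OF assms(3) f] show ?thesis
    by simp
qed

text \<open>Both \<open>pmf d y\<close> and \<open>pmf d' y\<close> are the limit of the same Cesaro
  means, those of \<open>indicator {y}\<close>.\<close>

lemma stationary_unique:
  assumes "stochastic P" and "unichain P" and "stationary_for P d" and "stationary_for P d'"
  shows "d = d'"
proof (rule pmf_eqI)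
  fix y
  have "(\<Sum>x\<in>UNIV. pmf d x * indicator {y} x) = (\<Sum>x\<in>UNIV. pmf d' x * indicator {y} x)"
    by (rule LIMSEQ_unique[OF unichain_cesaro[OF assms(1-3)] unichain_cesaro[OF assms(1,2,4)]])
  then show "pmf d y = pmf d' y"
    by simp
qed

text \<open>The mass at \<open>y\<close> is taken to be \<open>c y\<close>, the constant in the
  decomposition of \<open>indicator {y}\<close>. As a limit of Cesaro means it inherits
  nonnegativity and total mass one.\<close>

lemma stationary_exists:
  fixes P :: "'x::finite \<Rightarrow> 'x \<Rightarrow> real"
  assumes P: "stochastic P" and uni: "unichain P"
  shows "\<exists>d. stationary_for P d"
proof -
  \<comment> \<open>The starting state \<open>undefined\<close> is arbitrary.\<close>
  define avg where "avg f N = (\<Sum>k=0..N. (transition_op P ^^ k) f undefined) / real (Suc N)" for f N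
  have "\<exists>c u. indicator {y} = (\<lambda>x. c + u x - transition_op P u x)" for y
    by (rule unichain_poisson_solvable[OF P uni])
  then obtain c u where cu: "\<And>y. indicator {y} = (\<lambda>x. c y + u y x - transition_op P (u y) x)"
    by metis
  have c: "avg (indicator {y}) \<longlonglongrightarrow> c y" for y
    using cesaro_telescope[OF P cu] unfolding avg_def .
  \<comment> \<open>Expanding \<open>f\<close> in indicators carries the limits \<open>c x\<close>
    over to every function.\<close>
  have avg_sum: "avg f N = (\<Sum>x\<in>UNIV. f x * avg (indicator {x}) N)" for f N
  proof -
    have pow: "(transition_op P ^^ k) f z =
        (\<Sum>x\<in>UNIV. f x * (transition_op P ^^ k) (indicator {x}) z)" for k z
    proof (induction k arbitrary: z)
      case (Suc k)
      have "(transition_op P ^^ Suc k) f z =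
          (\<Sum>y\<in>UNIV. \<Sum>x\<in>UNIV. P z y * (f x * (transition_op P ^^ k) (indicator {x}) y))"
        by (simp add: transition_op_def[of P "(transition_op P ^^ k) f"] Suc sum_distrib_left)
      also have "\<dots> = (\<Sum>x\<in>UNIV. f x * (transition_op P ^^ Suc k) (indicator {x}) z)"
        by (subst sum.swap)
          (simp add: transition_op_def[of P "(transition_op P ^^ k) (indicator _)"]
            sum_distrib_left ac_simps)
      finally show ?case .
    qed (simp add: indicator_def)
    show ?thesis
      unfolding avg_def pow by (subst sum.swap) (simp add: sum_distrib_left sum_divide_distrib)
  qed
  have lim: "avg f \<longlonglongrightarrow> (\<Sum>x\<in>UNIV. f x * c x)" for f
  proof -
    have "avg f = (\<lambda>N. \<Sum>x\<in>UNIV. f x * avg (indicator {x}) N)"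
      by (rule ext) (rule avg_sum)
    moreover have "(\<lambda>N. \<Sum>x\<in>UNIV. f x * avg (indicator {x}) N) \<longlonglongrightarrow> (\<Sum>x\<in>UNIV. f x * c x)"
      by (intro tendsto_intros c)
    ultimately show ?thesis
      by simp
  qed
  have "avg (\<lambda>_. 1) = (\<lambda>_. 1)"
    by (simp add: avg_def[abs_def] transition_pow_const[OF P])
  with lim[of "\<lambda>_. 1"] have c1: "(\<Sum>x\<in>UNIV. c x) = 1"
    by (simp add: LIMSEQ_const_iff)
  have c0: "0 \<le> c y" for y
    by (rule LIMSEQ_le_const[OF c])
      (auto simp: avg_def intro!: divide_nonneg_nonneg sum_nonneg transition_pow_nonneg P)
  \<comment> \<open>Invariance comes from computing the limit for
    \<open>transition_op P (indicator {y})\<close> twice: by expansion in indicators, and by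
    applying \<open>P\<close> to the decomposition of \<open>indicator {y}\<close>, which keeps
    \<open>c y\<close> and replaces \<open>u y\<close> by its image under \<open>P\<close>.\<close>
  have "(\<Sum>x\<in>UNIV. c x * P x y) = c y" for y
  proof (rule LIMSEQ_unique)
    have "transition_op P (indicator {y}) = (\<lambda>x. P x y)"
      by (simp add: transition_op_def fun_eq_iff)
    then show "avg (transition_op P (indicator {y})) \<longlonglongrightarrow> (\<Sum>x\<in>UNIV. c x * P x y)"
      using lim[of "\<lambda>x. P x y"] by (simp add: mult.commute)
    have "transition_op P (indicator {y}) =
        (\<lambda>x. c y + transition_op P (u y) x - transition_op P (transition_op P (u y)) x)"
      unfolding arg_cong[OF cu[of y], of "transition_op P"] transition_op_diff transition_op_add
        transition_op_const[OF P] ..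
    then show "avg (transition_op P (indicator {y})) \<longlonglongrightarrow> c y"
      unfolding avg_def by (rule cesaro_telescope[OF P])
  qed
  moreover have "pmf (embed_pmf c) x = c x" for x
    by (rule pmf_embed_pmf) (use c0 c1 in \<open>simp_all add: nn_integral_count_space_finite sum_ennreal\<close>)
  ultimately have "stationary_for P (embed_pmf c)"
    by (simp add: stationary_for_def)
  then show ?thesis
    by blast
qed

section \<open>The law of the decision epochs\<close>

context smdp
begin

section \<open>One epoch: from the sojourn law to the embedded chain\<close>

lemma measurable_law: "measurable (sojourn_law S x a) N = measurable (sojourn_space S) N"
  by (rule measurable_cong_sets[OF sets_law refl])

lemma nn_integral_epoch_law:
  assumes g: "g \<in> borel_measurable (epoch_space S)"
  shows "(\<integral>\<^sup>+z. g z \<partial>epoch_law S \<pi> x) =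
    (\<Sum>a\<in>UNIV. ennreal (pmf (\<pi> x) a) * (\<integral>\<^sup>+w. g (x, a, w) \<partial>sojourn_law S x a))"
proof -
  have "(\<lambda>a. distr (sojourn_law S x a) (epoch_space S) (\<lambda>w. (x, a, w))) \<in>
      measurable (measure_pmf (\<pi> x)) (subprob_algebra (epoch_space S))"
    using distr_law_in_prob_algebra by (intro measurable_prob_algebraD) simp
  from nn_integral_bind[OF g this] show ?thesis
    unfolding epoch_law_def
    by (simp add: nn_integral_distr[OF triple_measurable] g nn_integral_measure_pmf
        nn_integral_count_space_finite)
qed

text \<open>The events \<open>A y\<close> partition the sample space by the value of the next state,
  so the integrand is a finite combination of indicators.\<close>

lemma nn_integral_next_state:
  assumes "\<And>y. 0 \<le> f y"
  shows "(\<integral>\<^sup>+w. ennreal (f (next_state S w)) \<partial>sojourn_law S x a) =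
    ennreal (\<Sum>y\<in>UNIV. trans_prob S y x a * f y)"
proof -
  interpret prob_space "sojourn_law S x a"
    by (rule prob_space_law)
  define A where "A y = {w \<in> space (sojourn_space S). next_state S w = y}" for y
  have A: "A y \<in> sets (sojourn_law S x a)" for y
  proof -
    have "next_state S -` {y} \<inter> space (sojourn_space S) \<in> sets (sojourn_space S)"
      by (rule measurable_sets[OF next_state_measurable]) simp
    moreover have "A y = next_state S -` {y} \<inter> space (sojourn_space S)"
      by (auto simp: A_def)
    ultimately show ?thesis
      by (simp add: sets_law)
  qed
  have "(\<integral>\<^sup>+w. ennreal (f (next_state S w)) \<partial>sojourn_law S x a) =
      (\<integral>\<^sup>+w. (\<Sum>y\<in>UNIV. ennreal (f y) * indicator (A y) w) \<partial>sojourn_law S x a)"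
    by (intro nn_integral_cong) (simp add: A_def space_law indicator_def)
  also have "\<dots> = (\<Sum>y\<in>UNIV. ennreal (f y) * emeasure (sojourn_law S x a) (A y))"
    using A by (subst nn_integral_sum) (auto simp: nn_integral_cmult_indicator)
  also have "\<dots> = (\<Sum>y\<in>UNIV. ennreal (trans_prob S y x a * f y))"
    using assms by (simp add: trans_prob_def A_def[symmetric] emeasure_eq_measure ennreal_mult'
        mult.commute)
  also have "\<dots> = ennreal (\<Sum>y\<in>UNIV. trans_prob S y x a * f y)"
    using assms by (intro sum_ennreal) (simp add: trans_prob_def)
  finally show ?thesis .
qed

lemma sum_trans_prob: "(\<Sum>y\<in>UNIV. trans_prob S y x a) = 1"
proof -
  interpret prob_space "sojourn_law S x a"
    by (rule prob_space_law)
  have "ennreal (\<Sum>y\<in>UNIV. trans_prob S y x a) = ennreal 1"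
    using nn_integral_next_state[of "\<lambda>_. 1" x a] by (simp add: emeasure_space_1)
  then show ?thesis
    by (subst (asm) ennreal_inj) (auto simp: trans_prob_def intro!: sum_nonneg)
qed

lemma transition_op_trans_pol:
  "transition_op (trans_pol S \<pi>) f x =
    (\<Sum>a\<in>UNIV. pmf (\<pi> x) a * (\<Sum>y\<in>UNIV. trans_prob S y x a * f y))"
  unfolding transition_op_def trans_pol_def sum_distrib_left sum_distrib_right
  by (subst sum.swap) (simp add: mult.assoc)

lemma stochastic_trans_pol: "stochastic (trans_pol S \<pi>)"
  unfolding stochastic_def
proof (intro conjI allI)
  show "0 \<le> trans_pol S \<pi> x y" for x y
    by (auto simp: trans_pol_def trans_prob_def intro!: sum_nonneg)
  show "(\<Sum>y\<in>UNIV. trans_pol S \<pi> x y) = 1" for x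
    using transition_op_trans_pol[of \<pi> "\<lambda>_. 1" x]
    by (simp add: transition_op_def sum_trans_prob sum_pmf_finite_UNIV)
qed

lemma next_state_epoch_measurable:
  "(\<lambda>z. next_state S (snd (snd z))) \<in> measurable (epoch_space S) (count_space UNIV)"
proof -
  have "(\<lambda>z. snd (snd z)) \<in> measurable (epoch_space S) (sojourn_space S)"
    unfolding epoch_space_def by measurable
  from measurable_compose[OF this next_state_measurable] show ?thesis .
qed

text \<open>Here the sample-point model meets the embedded chain: averaging a function of the next
  state over one epoch is one application of the transition operator.\<close>

lemma nn_integral_epoch_law_next_state:
  assumes "\<And>y. 0 \<le> f y"
  shows "(\<integral>\<^sup>+z. ennreal (f (next_state S (snd (snd z)))) \<partial>epoch_law S \<pi> x) =
    ennreal (transition_op (trans_pol S \<pi>) f x)"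
proof -
  have "(\<lambda>z. ennreal (f (next_state S (snd (snd z))))) \<in> borel_measurable (epoch_space S)"
    by (rule measurable_compose[OF next_state_epoch_measurable]) simp
  moreover have nn: "0 \<le> (\<Sum>y\<in>UNIV. trans_prob S y x a * f y)" for a
    using assms by (auto simp: trans_prob_def intro!: sum_nonneg)
  ultimately show ?thesis
    by (simp add: nn_integral_epoch_law nn_integral_next_state assms transition_op_trans_pol
        sum_ennreal flip: ennreal_mult)
qed

section \<open>Marginals and expectations along a trajectory\<close>

text \<open>Markov property, with \<open>f x\<close> the mean of \<open>g\<close> over an epoch
  starting in \<open>x\<close>. Integrating out the last coordinate leaves \<open>f\<close> of the
  next state of the previous epoch, which costs one transition operator.\<close>

lemma nn_integral_trajectories:
  assumes "g \<in> borel_measurable (epoch_space S)"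
    and "\<And>x. (\<integral>\<^sup>+z. g z \<partial>epoch_law S \<pi> x) = ennreal (f x)"
    and "\<And>x. 0 \<le> f x"
  shows "(\<integral>\<^sup>+\<omega>. g (\<omega> k) \<partial>trajectories S \<pi> \<mu>) =
    ennreal (\<Sum>x\<in>UNIV. pmf \<mu> x * (transition_op (trans_pol S \<pi>) ^^ k) f x)"
proof -
  let ?K = "epoch_kernel S \<pi> \<mu>" and ?M = "\<lambda>_::nat. epoch_space S"
  interpret IT: Ionescu_Tulcea ?K ?M
    by (rule Ionescu_Tulcea_epoch_kernel)
  \<comment> \<open>\<open>E n\<close> is the joint law of the first \<open>n\<close> epochs, so
    coordinate \<open>k\<close> first occurs in \<open>E (Suc k)\<close>. The
    all-\<open>undefined\<close> function is the empty history.\<close>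
  define E where "E n = IT.C 0 n (\<lambda>_. undefined)" for n
  have undef: "(\<lambda>_. undefined) \<in> space (PiM {0..<0} ?M)"
    by simp
  have spaceE: "space (E n) = space (PiM {0..<n} ?M)" for n
    using IT.space_C[OF undef, of n] by (simp add: E_def)
  have setsE: "sets (E n) = sets (PiM {0..<n} ?M)" for n
    using IT.sets_C[OF undef, of n] by (simp add: E_def)
  have coord: "(\<lambda>\<omega>. g (\<omega> k)) \<in> borel_measurable (PiM {0..<Suc k} ?M)"
    if "g \<in> borel_measurable (epoch_space S)" for g :: "_ \<Rightarrow> ennreal" and k
    by (rule measurable_compose[OF _ that]) (rule measurable_component_singleton, simp)
  have step: "(\<integral>\<^sup>+\<omega>. g (\<omega> k) \<partial>E (Suc k)) = (\<integral>\<^sup>+\<omega>. (\<integral>\<^sup>+z. g z \<partial>?K k \<omega>) \<partial>E k)"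
    if g: "g \<in> borel_measurable (epoch_space S)" for g :: "_ \<Rightarrow> ennreal" and k
  proof -
    have "IT.eP k \<in> measurable (E k) (subprob_algebra (PiM {0..<Suc k} ?M))"
      unfolding measurable_cong_sets[OF setsE refl] by (rule IT.measurable_eP)
    from nn_integral_bind[OF coord[OF g] this]
    have "(\<integral>\<^sup>+\<omega>. g (\<omega> k) \<partial>E (Suc k)) = (\<integral>\<^sup>+\<omega>. (\<integral>\<^sup>+\<omega>'. g (\<omega>' k) \<partial>IT.eP k \<omega>) \<partial>E k)"
      by (simp add: E_def)
    also have "\<dots> = (\<integral>\<^sup>+\<omega>. (\<integral>\<^sup>+z. g z \<partial>?K k \<omega>) \<partial>E k)"
      by (intro nn_integral_cong) (simp add: spaceE IT.nn_integral_eP[OF _ coord[OF g]])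
    finally show ?thesis .
  qed
  \<comment> \<open>Both \<open>g\<close> and \<open>f\<close> vary in the induction: its step
    replaces \<open>g\<close> by \<open>f\<close> of the next state, and \<open>f\<close> by its
    image under the transition operator.\<close>
  have E: "(\<integral>\<^sup>+\<omega>. g (\<omega> k) \<partial>E (Suc k)) =
      ennreal (\<Sum>x\<in>UNIV. pmf \<mu> x * (transition_op (trans_pol S \<pi>) ^^ k) f x)"
    using assms
  proof (induction k arbitrary: g f)
    case 0
    have "epoch_law S \<pi> \<in> measurable (measure_pmf \<mu>) (subprob_algebra (epoch_space S))"
      using epoch_law_in_prob_algebra by (intro measurable_prob_algebraD) simp
    from nn_integral_bind[OF 0(1) this]
    have "(\<integral>\<^sup>+z. g z \<partial>?K 0 \<omega>) = ennreal (\<Sum>x\<in>UNIV. pmf \<mu> x * f x)" for \<omega>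
      using 0(3)
      by (simp add: epoch_kernel_def 0(2) nn_integral_measure_pmf nn_integral_count_space_finite
          sum_ennreal flip: ennreal_mult)
    moreover have "emeasure (E 0) (space (E 0)) = 1"
      using IT.prob_space_C[OF undef, of 0] unfolding E_def by (rule prob_space.emeasure_space_1)
    ultimately show ?case
      by (simp add: step[OF 0(1)])
  next
    case (Suc k)
    have "(\<integral>\<^sup>+\<omega>. g (\<omega> (Suc k)) \<partial>E (Suc (Suc k))) =
        (\<integral>\<^sup>+\<omega>. ennreal (f (next_state S (snd (snd (\<omega> k))))) \<partial>E (Suc k))"
      by (simp add: step[OF Suc(2)] epoch_kernel_def Suc(3))
    also have "\<dots> = ennreal (\<Sum>x\<in>UNIV. pmf \<mu> x *
        (transition_op (trans_pol S \<pi>) ^^ k) (transition_op (trans_pol S \<pi>) f) x)"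
    proof (rule Suc.IH)
      show "(\<lambda>z. ennreal (f (next_state S (snd (snd z))))) \<in> borel_measurable (epoch_space S)"
        by (rule measurable_compose[OF next_state_epoch_measurable]) simp
    qed (simp_all add: nn_integral_epoch_law_next_state Suc(4)
        transition_op_nonneg[OF stochastic_trans_pol])
    finally show ?case
      by (simp only: funpow_Suc_right comp_apply)
  qed
  \<comment> \<open>\<open>CI J\<close> restricts the law of the first \<open>up_to J\<close> epochs
    to \<open>J\<close>. For the initial segment used here that number is its length, so the
    marginal has the same integral as \<open>E (Suc k)\<close>.\<close>
  have "IT.up_to {0..<Suc k} \<le> n \<longleftrightarrow> Suc k \<le> n" for n
    by (subst IT.up_to_iff) (auto simp: Suc_le_eq)
  then have up_to: "IT.up_to {0..<Suc k} = Suc k"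
    by (metis antisym order_refl)
  have g: "(\<lambda>\<omega>. g (\<omega> k)) \<in> borel_measurable (PiM {0..<Suc k} ?M)"
    by (rule coord[OF assms(1)])
  have "sets (trajectories S \<pi> \<mu>) = sets (PiM UNIV ?M)"
    unfolding trajectories_def by (rule IT.PF.sets_lim)
  then have "(\<lambda>\<omega>. restrict \<omega> {0..<Suc k}) \<in>
      measurable (trajectories S \<pi> \<mu>) (PiM {0..<Suc k} ?M)"
    by (subst measurable_cong_sets[OF _ refl]) (auto intro: measurable_restrict_subset)
  from nn_integral_distr[OF this, of "\<lambda>\<omega>. g (\<omega> k)"] g
  have "(\<integral>\<^sup>+\<omega>. g (\<omega> k) \<partial>trajectories S \<pi> \<mu>) = (\<integral>\<^sup>+\<omega>. g (\<omega> k)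
      \<partial>distr (trajectories S \<pi> \<mu>) (PiM {0..<Suc k} ?M) (\<lambda>\<omega>. restrict \<omega> {0..<Suc k}))"
    by simp
  also have "\<dots> = (\<integral>\<^sup>+\<omega>. g (\<omega> k) \<partial>IT.CI {0..<Suc k})"
    by (subst trajectories_marginal) simp_all
  also have "\<dots> = (\<integral>\<^sup>+\<omega>. g (\<omega> k) \<partial>E (Suc k))"
  proof -
    have "(\<lambda>\<omega>. restrict \<omega> {0..<Suc k}) \<in> measurable (E (Suc k)) (PiM {0..<Suc k} ?M)"
      unfolding measurable_cong_sets[OF setsE refl] by (rule measurable_restrict_subset) simp
    from nn_integral_distr[OF this, of "\<lambda>\<omega>. g (\<omega> k)"] g show ?thesis
      by (simp add: IT.CI_def up_to E_def)
  qed
  finally show ?thesis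
    using E by simp
qed

lemma coordinate_measurable: "(\<lambda>\<omega>. \<omega> k) \<in> measurable (trajectories S \<pi> \<mu>) (epoch_space S)"
proof -
  interpret IT: Ionescu_Tulcea "epoch_kernel S \<pi> \<mu>" "\<lambda>_. epoch_space S"
    by (rule Ionescu_Tulcea_epoch_kernel)
  have "sets (trajectories S \<pi> \<mu>) = sets (PiM UNIV (\<lambda>_. epoch_space S))"
    unfolding trajectories_def by (rule IT.PF.sets_lim)
  then show ?thesis
    by (subst measurable_cong_sets[OF _ refl]) (auto intro: measurable_component_singleton)
qed

definition epoch_mean ::
    "('x, 'a) policy \<Rightarrow> ('x \<times> 'a \<times> 'w \<Rightarrow> real) \<Rightarrow> 'x \<Rightarrow> real" where
  "epoch_mean \<pi> g x = (\<Sum>a\<in>UNIV. pmf (\<pi> x) a * (LINT w|sojourn_law S x a. g (x, a, w)))"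

lemma trajectories_expectation_nonneg:
  assumes g: "g \<in> borel_measurable (epoch_space S)"
    and nonneg: "\<And>z. z \<in> space (epoch_space S) \<Longrightarrow> 0 \<le> g z"
    and int: "\<And>x a. integrable (sojourn_law S x a) (\<lambda>w. g (x, a, w))"
  shows "has_bochner_integral (trajectories S \<pi> \<mu>) (\<lambda>\<omega>. g (\<omega> k))
    (\<Sum>x\<in>UNIV. pmf \<mu> x * (transition_op (trans_pol S \<pi>) ^^ k) (epoch_mean \<pi> g) x)"
proof (rule has_bochner_integral_nn_integral)
  have nonneg': "0 \<le> g (x, a, w)" if "w \<in> space (sojourn_law S x a)" for x a w
    using that by (intro nonneg) (simp add: epoch_space_def space_pair_measure space_law)
  have int_nonneg: "0 \<le> (LINT w|sojourn_law S x a. g (x, a, w))" for x a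
    by (rule Bochner_Integration.integral_nonneg) (rule nonneg')
  have mean_nonneg: "0 \<le> epoch_mean \<pi> g x" for x
    by (auto simp: epoch_mean_def int_nonneg intro!: sum_nonneg)
  have "(\<integral>\<^sup>+z. ennreal (g z) \<partial>epoch_law S \<pi> x) = ennreal (epoch_mean \<pi> g x)" for x
    using g
    by (simp add: nn_integral_epoch_law nn_integral_eq_integral[OF int] nonneg' epoch_mean_def
        int_nonneg sum_ennreal flip: ennreal_mult)
  with g mean_nonneg
  show "(\<integral>\<^sup>+\<omega>. ennreal (g (\<omega> k)) \<partial>trajectories S \<pi> \<mu>) = ennreal
      (\<Sum>x\<in>UNIV. pmf \<mu> x * (transition_op (trans_pol S \<pi>) ^^ k) (epoch_mean \<pi> g) x)"
    by (intro nn_integral_trajectories) auto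
  show "0 \<le> (\<Sum>x\<in>UNIV. pmf \<mu> x * (transition_op (trans_pol S \<pi>) ^^ k) (epoch_mean \<pi> g) x)"
    by (intro sum_nonneg mult_nonneg_nonneg transition_pow_nonneg stochastic_trans_pol mean_nonneg)
      simp
  show "(\<lambda>\<omega>. g (\<omega> k)) \<in> borel_measurable (trajectories S \<pi> \<mu>)"
    by (rule measurable_compose[OF coordinate_measurable g])
  show "AE \<omega> in trajectories S \<pi> \<mu>. 0 \<le> g (\<omega> k)"
    using measurable_space[OF coordinate_measurable] by (intro AE_I2 nonneg) auto
qed

text \<open>Positive and negative parts reduce this to the nonnegative case, since the value is
  linear in \<open>g\<close>.\<close>

lemma trajectories_expectation:
  assumes g: "g \<in> borel_measurable (epoch_space S)"
    and int: "\<And>x a. integrable (sojourn_law S x a) (\<lambda>w. g (x, a, w))"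
  shows "has_bochner_integral (trajectories S \<pi> \<mu>) (\<lambda>\<omega>. g (\<omega> k))
    (\<Sum>x\<in>UNIV. pmf \<mu> x * (transition_op (trans_pol S \<pi>) ^^ k) (epoch_mean \<pi> g) x)"
proof -
  let ?p = "\<lambda>z. max 0 (g z)" and ?n = "\<lambda>z. max 0 (- g z)"
  have "has_bochner_integral (trajectories S \<pi> \<mu>) (\<lambda>\<omega>. ?p (\<omega> k))
      (\<Sum>x\<in>UNIV. pmf \<mu> x * (transition_op (trans_pol S \<pi>) ^^ k) (epoch_mean \<pi> ?p) x)"
    and "has_bochner_integral (trajectories S \<pi> \<mu>) (\<lambda>\<omega>. ?n (\<omega> k))
      (\<Sum>x\<in>UNIV. pmf \<mu> x * (transition_op (trans_pol S \<pi>) ^^ k) (epoch_mean \<pi> ?n) x)"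
    by (rule trajectories_expectation_nonneg; use g int in simp)+
  from has_bochner_integral_diff[OF this]
  have "has_bochner_integral (trajectories S \<pi> \<mu>) (\<lambda>\<omega>. ?p (\<omega> k) - ?n (\<omega> k))
      (\<Sum>x\<in>UNIV. pmf \<mu> x *
        (transition_op (trans_pol S \<pi>) ^^ k) (\<lambda>x. epoch_mean \<pi> ?p x - epoch_mean \<pi> ?n x) x)"
    by (simp add: transition_pow_diff right_diff_distrib sum_subtractf)
  moreover have pn: "?p z - ?n z = g z" for z
    by (simp add: max_def)
  moreover have "epoch_mean \<pi> ?p x - epoch_mean \<pi> ?n x = epoch_mean \<pi> g x" for x
  proof -
    have "epoch_mean \<pi> ?p x - epoch_mean \<pi> ?n x =
        (\<Sum>a\<in>UNIV. pmf (\<pi> x) a * (LINT w|sojourn_law S x a. ?p (x, a, w) - ?n (x, a, w)))"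
      using int
      by (simp add: epoch_mean_def Bochner_Integration.integral_diff right_diff_distrib sum_subtractf)
    then show ?thesis
      by (simp only: pn epoch_mean_def)
  qed
  ultimately show ?thesis
    by simp
qed

section \<open>Moments of the sojourn time\<close>

text \<open>Layer-cake formula: the sojourn time is the length of \<open>{0..<?T w}\<close>, and
  Tonelli turns its mean into the integral of the tail \<open>1 - sojourn_cdf S s x a\<close>. The
  half-open interval matches the complement of the event \<open>?T w \<le> s\<close>.\<close>

lemma sojourn_time_integral:
  "has_bochner_integral (sojourn_law S x a) (sojourn_time S) (mean_time S x a)"
proof (rule has_bochner_integral_nn_integral)
  interpret prob_space "sojourn_law S x a"
    by (rule prob_space_law)
  interpret pair_sigma_finite "sojourn_law S x a" lborel ..
  let ?T = "sojourn_time S"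
  have T[measurable]: "?T \<in> borel_measurable (sojourn_law S x a)"
    using time_measurable by (simp add: measurable_law)
  then show "?T \<in> borel_measurable (sojourn_law S x a)" .
  show "AE w in sojourn_law S x a. 0 \<le> ?T w"
    by (intro AE_I2 time_nonneg) (simp add: space_law)
  have le_set: "{w \<in> space (sojourn_space S). ?T w \<le> s} \<in> events" for s
    unfolding space_law[of x a, symmetric] by measurable
  have cdf_le: "sojourn_cdf S s x a \<le> 1" for s
    by (simp add: sojourn_cdf_def)
  then show "0 \<le> mean_time S x a"
    unfolding mean_time_def set_lebesgue_integral_def
    by (intro Bochner_Integration.integral_nonneg) (simp add: indicator_def)
  have gt: "emeasure (sojourn_law S x a) {w \<in> space (sojourn_law S x a). s < ?T w} =
      ennreal (1 - sojourn_cdf S s x a)" for s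
  proof -
    have "{w \<in> space (sojourn_law S x a). s < ?T w} =
        space (sojourn_law S x a) - {w \<in> space (sojourn_space S). ?T w \<le> s}"
      by (auto simp: space_law)
    with prob_compl[OF le_set[of s]] show ?thesis
      by (simp add: emeasure_eq_measure sojourn_cdf_def)
  qed
  have "(\<integral>\<^sup>+w. ennreal (?T w) \<partial>sojourn_law S x a) =
      (\<integral>\<^sup>+w. (\<integral>\<^sup>+s. indicator {0..<?T w} s \<partial>lborel) \<partial>sojourn_law S x a)"
    by (intro nn_integral_cong) (simp add: space_law time_nonneg)
  \<comment> \<open>The indicator is rewritten as a condition on the pair, whose joint measurability
    Tonelli requires.\<close>
  also have "\<dots> = (\<integral>\<^sup>+w. (\<integral>\<^sup>+s. (if 0 \<le> s \<and> s < ?T w then 1 else 0) \<partial>lborel) \<partial>sojourn_law S x a)"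
    by (intro nn_integral_cong) (simp add: indicator_def)
  also have "\<dots> = (\<integral>\<^sup>+s. (\<integral>\<^sup>+w. (if 0 \<le> s \<and> s < ?T w then 1 else 0) \<partial>sojourn_law S x a) \<partial>lborel)"
    by (rule Fubini'[symmetric]) measurable
  also have "\<dots> = (\<integral>\<^sup>+s. ennreal (indicator {0..} s *\<^sub>R (1 - sojourn_cdf S s x a)) \<partial>lborel)"
  proof (intro nn_integral_cong)
    fix s
    have "(\<integral>\<^sup>+w. (if 0 \<le> s \<and> s < ?T w then 1 else 0) \<partial>sojourn_law S x a) =
        (\<integral>\<^sup>+w. indicator {0..} s * indicator {w \<in> space (sojourn_law S x a). s < ?T w} w \<partial>sojourn_law S x a)"
      by (intro nn_integral_cong) (simp add: indicator_def)
    also have "\<dots> = ennreal (indicator {0..} s *\<^sub>R (1 - sojourn_cdf S s x a))"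
      by (subst nn_integral_cmult_indicator) (auto simp: gt indicator_def)
    finally show "(\<integral>\<^sup>+w. (if 0 \<le> s \<and> s < ?T w then 1 else 0) \<partial>sojourn_law S x a) =
        ennreal (indicator {0..} s *\<^sub>R (1 - sojourn_cdf S s x a))" .
  qed
  also have "\<dots> = ennreal (mean_time S x a)"
    unfolding mean_time_def set_lebesgue_integral_def
    using finite_mean_time[of x a] cdf_le
    by (intro nn_integral_eq_integral) (auto simp: set_integrable_def indicator_def)
  finally show "(\<integral>\<^sup>+w. ennreal (?T w) \<partial>sojourn_law S x a) = ennreal (mean_time S x a)" .
qed

text \<open>A nonnegative time with mean zero vanishes almost surely; its distribution function
  would then be 1 at \<open>\<delta>\<close>, against \<open>no_accumulation\<close>.\<close>

lemma mean_time_pos: "0 < mean_time S x a"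
proof (rule ccontr)
  interpret prob_space "sojourn_law S x a"
    by (rule prob_space_law)
  note T = sojourn_time_integral[of x a, unfolded has_bochner_integral_iff, THEN conjunct1]
    sojourn_time_integral[of x a, unfolded has_bochner_integral_iff, THEN conjunct2]
  have nn: "AE w in sojourn_law S x a. 0 \<le> sojourn_time S w"
    by (intro AE_I2 time_nonneg) (simp add: space_law)
  assume "\<not> 0 < mean_time S x a"
  with T(2) integral_nonneg_AE[OF nn] have "(LINT w|sojourn_law S x a. sojourn_time S w) = 0"
    by simp
  with integral_nonneg_eq_0_iff_AE[OF T(1) nn]
  have zero: "AE w in sojourn_law S x a. sojourn_time S w = 0"
    by simp
  obtain \<epsilon> \<delta> where "0 < \<epsilon>" "0 < \<delta>" "sojourn_cdf S \<delta> x a \<le> 1 - \<epsilon>"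
    using no_accumulation by blast
  moreover have "sojourn_cdf S \<delta> x a = 1"
    unfolding sojourn_cdf_def space_law[of x a, symmetric]
  proof (rule prob_Collect_eq_1[THEN iffD2])
    show "{w \<in> space (sojourn_law S x a). sojourn_time S w \<le> \<delta>} \<in> events"
      using borel_measurable_integrable[OF T(1)] by simp
    show "AE w in sojourn_law S x a. sojourn_time S w \<le> \<delta>"
      using zero \<open>0 < \<delta>\<close> by auto
  qed
  ultimately show False
    by simp
qed

section \<open>Average cost\<close>

lemma state_action_expectation:
  "has_bochner_integral (trajectories S \<pi> \<mu>) (\<lambda>\<omega>. f (epoch_state k \<omega>) (epoch_action k \<omega>))
    (\<Sum>x\<in>UNIV. pmf \<mu> x *
      (transition_op (trans_pol S \<pi>) ^^ k) (\<lambda>x. \<Sum>a\<in>UNIV. f x a * pmf (\<pi> x) a) x)"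
proof -
  interpret law: prob_space "sojourn_law S x a" for x a
    by (rule prob_space_law)
  have "(\<lambda>z. f (fst z) (fst (snd z))) \<in> borel_measurable (epoch_space S)"
  \<comment> \<open>The state takes finitely many values, so it may be fixed while the dependence on
    the action is treated.\<close>
  proof (rule measurable_compose_countable[of "\<lambda>x z. f x (fst (snd z))" _ _ fst])
    have "(\<lambda>z. fst (snd z)) \<in> measurable (epoch_space S) (count_space UNIV)"
      unfolding epoch_space_def by measurable
    then show "(\<lambda>z. f x (fst (snd z))) \<in> borel_measurable (epoch_space S)" for x
      by (rule measurable_compose) simp
    show "fst \<in> measurable (epoch_space S) (count_space UNIV)"
      unfolding epoch_space_def by measurable
  qed
  from trajectories_expectation[OF this, of \<pi> \<mu> k] show ?thesis
    by (simp add: epoch_mean_def[abs_def] law.prob_space epoch_state_def epoch_action_def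
        mult.commute)
qed

lemma sojourn_expectation:
  "has_bochner_integral (trajectories S \<pi> \<mu>) (epoch_sojourn S k)
    (\<Sum>x\<in>UNIV. pmf \<mu> x * (transition_op (trans_pol S \<pi>) ^^ k) (mean_time_pol S \<pi>) x)"
proof -
  have "(\<lambda>z. snd (snd z)) \<in> measurable (epoch_space S) (sojourn_space S)"
    unfolding epoch_space_def by measurable
  from measurable_compose[OF this time_measurable]
  have "(\<lambda>z. sojourn_time S (snd (snd z))) \<in> borel_measurable (epoch_space S)" .
  from trajectories_expectation[OF this, of \<pi> \<mu> k] show ?thesis
    using sojourn_time_integral
    by (simp add: has_bochner_integral_iff epoch_mean_def[abs_def] mean_time_pol_def[abs_def]
        epoch_sojourn_def[abs_def] mult.commute)
qed

text \<open>Existence and uniqueness justify the definite description in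
  \<open>stat_dist\<close>.\<close>

lemma stationary_for_stat_dist: "stationary_for (trans_pol S \<pi>) (stat_dist S \<pi>)"
  unfolding stat_dist_def
proof (rule theI', rule ex_ex1I)
  show "\<exists>d. stationary_for (trans_pol S \<pi>) d"
    by (rule stationary_exists[OF stochastic_trans_pol unichain_pol])
qed (rule stationary_unique[OF stochastic_trans_pol unichain_pol])

text \<open>The limit in \<open>unichain_cesaro\<close> is the same from every starting state, so
  averaging over \<open>\<mu>\<close> leaves it unchanged.\<close>

lemma expected_cesaro:
  "(\<lambda>N. (\<Sum>k=0..N. \<Sum>x\<in>UNIV. pmf \<mu> x * (transition_op (trans_pol S \<pi>) ^^ k) f x) / real (Suc N))
    \<longlonglongrightarrow> measure_pmf.expectation (stat_dist S \<pi>) f"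
proof -
  have "(\<lambda>N. \<Sum>x\<in>UNIV. pmf \<mu> x *
        ((\<Sum>k=0..N. (transition_op (trans_pol S \<pi>) ^^ k) f x) / real (Suc N)))
      \<longlonglongrightarrow> (\<Sum>x\<in>UNIV. pmf \<mu> x * (\<Sum>x\<in>UNIV. pmf (stat_dist S \<pi>) x * f x))"
    by (intro tendsto_sum tendsto_mult tendsto_const unichain_cesaro stochastic_trans_pol
        unichain_pol stationary_for_stat_dist)
  moreover have "(\<Sum>x\<in>UNIV. pmf \<mu> x *
        ((\<Sum>k=0..N. (transition_op (trans_pol S \<pi>) ^^ k) f x) / real (Suc N))) =
      (\<Sum>k=0..N. \<Sum>x\<in>UNIV. pmf \<mu> x * (transition_op (trans_pol S \<pi>) ^^ k) f x) / real (Suc N)" for N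
    by (subst sum.swap) (simp add: sum_distrib_left sum_divide_distrib del: of_nat_Suc)
  ultimately show ?thesis
    by (simp add: sum_pmf_finite_UNIV integral_measure_pmf_real[of UNIV] mult.commute
        del: of_nat_Suc flip: sum_distrib_right)
qed

text \<open>Makes division by the mean epoch time legitimate. A point in the support of each
  distribution provides a positive summand.\<close>

lemma mean_epoch_time_pos: "0 < mean_epoch_time S \<pi>"
proof -
  have m: "0 < mean_time_pol S \<pi> x" for x
  proof -
    obtain a where "a \<in> set_pmf (\<pi> x)"
      using set_pmf_not_empty[of "\<pi> x"] by blast
    then have "0 < mean_time S x a * pmf (\<pi> x) a"
      by (simp add: mean_time_pos pmf_positive)
    then show ?thesis
      unfolding mean_time_pol_def
      by (intro sum_pos2[of _ a]) (auto intro!: mult_nonneg_nonneg less_imp_le[OF mean_time_pos])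
  qed
  obtain x where "x \<in> set_pmf (stat_dist S \<pi>)"
    using set_pmf_not_empty[of "stat_dist S \<pi>"] by blast
  then have "0 < mean_time_pol S \<pi> x * pmf (stat_dist S \<pi>) x"
    by (simp add: m pmf_positive)
  then show ?thesis
    unfolding mean_epoch_time_def
    by (subst integral_measure_pmf_real[of UNIV])
      (auto intro!: sum_pos2[of _ x] mult_nonneg_nonneg less_imp_le[OF m])
qed

lemma cost_ratio_tendsto:
  "cost_ratio S \<pi> \<mu> \<longlonglongrightarrow>
    measure_pmf.expectation (stat_dist S \<pi>) (epoch_cost_pol S \<pi>) / mean_epoch_time S \<pi>"
proof -
  define E where "E f N =
    (\<Sum>k=0..N. \<Sum>x\<in>UNIV. pmf \<mu> x * (transition_op (trans_pol S \<pi>) ^^ k) f x)" for f N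
  have "(LINT \<omega>|trajectories S \<pi> \<mu>.
      (\<Sum>k=0..N. epoch_cost S (epoch_state k \<omega>) (epoch_action k \<omega>))) = E (epoch_cost_pol S \<pi>) N" for N
    unfolding E_def epoch_cost_pol_def[abs_def]
    by (intro has_bochner_integral_integral_eq has_bochner_integral_sum state_action_expectation)
  moreover have "(LINT \<omega>|trajectories S \<pi> \<mu>. (\<Sum>k=0..N. epoch_sojourn S k \<omega>)) =
      E (mean_time_pol S \<pi>) N" for N
    unfolding E_def
    by (intro has_bochner_integral_integral_eq has_bochner_integral_sum sojourn_expectation)
  \<comment> \<open>Sums over \<open>0..N\<close> have \<open>Suc N\<close> terms; dividing both by
    this number makes them Cesaro means.\<close>
  ultimately have "cost_ratio S \<pi> \<mu> N =
      (E (epoch_cost_pol S \<pi>) N / real (Suc N)) / (E (mean_time_pol S \<pi>) N / real (Suc N))" for N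
    by (simp add: cost_ratio_def del: of_nat_Suc)
  moreover have "(\<lambda>N. (E (epoch_cost_pol S \<pi>) N / real (Suc N)) / (E (mean_time_pol S \<pi>) N / real (Suc N)))
      \<longlonglongrightarrow> measure_pmf.expectation (stat_dist S \<pi>) (epoch_cost_pol S \<pi>) / mean_epoch_time S \<pi>"
    using mean_epoch_time_pos[of \<pi>] unfolding E_def mean_epoch_time_def
    by (intro tendsto_divide expected_cesaro) simp
  ultimately show ?thesis
    by presburger
qed

text \<open>The limit of the ratios does not depend on \<open>\<mu>\<close>, so the definite
  description in \<open>avg_cost\<close> selects it.\<close>

lemma avg_cost_eq:
  "avg_cost S \<pi> =
    measure_pmf.expectation (stat_dist S \<pi>) (epoch_cost_pol S \<pi>) / mean_epoch_time S \<pi>"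
  unfolding avg_cost_def
proof (rule the_equality)
  show "\<eta> = measure_pmf.expectation (stat_dist S \<pi>) (epoch_cost_pol S \<pi>) / mean_epoch_time S \<pi>"
    if "\<forall>\<mu>. cost_ratio S \<pi> \<mu> \<longlonglongrightarrow> \<eta>" for \<eta>
    by (rule LIMSEQ_unique[OF that[rule_format] cost_ratio_tendsto])
qed (intro allI cost_ratio_tendsto)

section \<open>The performance difference formula\<close>

lemma performance_difference:
  "measure_pmf.expectation (stat_dist S \<pi>\<^sub>2)
      (\<lambda>x. measure_pmf.expectation (\<pi>\<^sub>2 x) (\<lambda>a. advantage S \<pi>\<^sub>1 x a)) =
    (avg_cost S \<pi>\<^sub>2 - avg_cost S \<pi>\<^sub>1) * mean_epoch_time S \<pi>\<^sub>2"
proof -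
  define h where "h = bias S \<pi>\<^sub>1"
  define d where "d = pmf (stat_dist S \<pi>\<^sub>2)"
  let ?g = "epoch_cost_pol S \<pi>\<^sub>2" and ?m = "mean_time_pol S \<pi>\<^sub>2"
  have stat: "(\<Sum>x\<in>UNIV. d x * transition_op (trans_pol S \<pi>\<^sub>2) h x) = (\<Sum>x\<in>UNIV. d x * h x)"
    unfolding d_def by (rule stationary_transition_op[OF stationary_for_stat_dist])
  have exp: "measure_pmf.expectation (stat_dist S \<pi>\<^sub>2) f = (\<Sum>x\<in>UNIV. d x * f x)" for f :: "'x \<Rightarrow> real"
    by (simp add: integral_measure_pmf_real[of UNIV] d_def mult.commute)
  \<comment> \<open>Averaging over actions of \<open>\<pi>\<^sub>2\<close> turns the kernel in the
    advantage into that of \<open>\<pi>\<^sub>2\<close>, while \<open>h\<close> and the average cost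
    stay those of \<open>\<pi>\<^sub>1\<close>.\<close>
  have "measure_pmf.expectation (\<pi>\<^sub>2 x) (\<lambda>a. advantage S \<pi>\<^sub>1 x a) =
      ?g x - avg_cost S \<pi>\<^sub>1 * ?m x + transition_op (trans_pol S \<pi>\<^sub>2) h x - h x" for x
  proof -
    have "measure_pmf.expectation (\<pi>\<^sub>2 x) (\<lambda>a. advantage S \<pi>\<^sub>1 x a) =
        (\<Sum>a\<in>UNIV. advantage S \<pi>\<^sub>1 x a * pmf (\<pi>\<^sub>2 x) a)"
      by (simp add: integral_measure_pmf_real[of UNIV])
    also have "\<dots> = ?g x - avg_cost S \<pi>\<^sub>1 * ?m x + transition_op (trans_pol S \<pi>\<^sub>2) h x -
        h x * (\<Sum>a\<in>UNIV. pmf (\<pi>\<^sub>2 x) a)"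
      unfolding advantage_def h_def[symmetric] epoch_cost_pol_def mean_time_pol_def
        transition_op_trans_pol
      by (simp add: left_diff_distrib distrib_right sum_subtractf sum.distrib
          sum_distrib_left[of "avg_cost S \<pi>\<^sub>1"] sum_distrib_left[of "h x"] mult.assoc
          mult.commute[of "pmf _ _"])
    finally show ?thesis
      by (simp add: sum_pmf_finite_UNIV)
  qed
  then have "measure_pmf.expectation (stat_dist S \<pi>\<^sub>2)
      (\<lambda>x. measure_pmf.expectation (\<pi>\<^sub>2 x) (\<lambda>a. advantage S \<pi>\<^sub>1 x a)) =
      (\<Sum>x\<in>UNIV. d x * (?g x - avg_cost S \<pi>\<^sub>1 * ?m x + transition_op (trans_pol S \<pi>\<^sub>2) h x - h x))"
    by (simp add: exp)
  also have "\<dots> = (\<Sum>x\<in>UNIV. d x * ?g x) - avg_cost S \<pi>\<^sub>1 * (\<Sum>x\<in>UNIV. d x * ?m x)"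
    using stat
    by (simp add: right_diff_distrib distrib_left sum_subtractf sum.distrib sum_distrib_left
        mult.left_commute)
  also have "(\<Sum>x\<in>UNIV. d x * ?g x) = avg_cost S \<pi>\<^sub>2 * mean_epoch_time S \<pi>\<^sub>2"
    using mean_epoch_time_pos[of \<pi>\<^sub>2] by (simp add: avg_cost_eq exp)
  also have "(\<Sum>x\<in>UNIV. d x * ?m x) = mean_epoch_time S \<pi>\<^sub>2"
    by (simp add: mean_epoch_time_def exp)
  finally show ?thesis
    by (simp add: left_diff_distrib)
qed

end

theorem lemma21:
  fixes S :: "('x::finite, 'a::finite, 'w) smdp_model"
    and \<pi>\<^sub>1 \<pi>\<^sub>2 :: "('x, 'a) policy"
  assumes "smdp S"
    and "\<And>x. summable (relative_cost S \<pi>\<^sub>1 x)"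
  shows "avg_cost S \<pi>\<^sub>2 - avg_cost S \<pi>\<^sub>1 =
    1 / mean_epoch_time S \<pi>\<^sub>2 *
      measure_pmf.expectation (stat_dist S \<pi>\<^sub>2)
        (\<lambda>x. measure_pmf.expectation (\<pi>\<^sub>2 x) (\<lambda>a. advantage S \<pi>\<^sub>1 x a))"
proof -
  interpret smdp S
    by fact
  show ?thesis
    using performance_difference[of \<pi>\<^sub>2 \<pi>\<^sub>1] mean_epoch_time_pos[of \<pi>\<^sub>2] by simp
qed

end
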